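(* Let $m>3$ and $n>3$ be integers and let $\Gamma_{m,n}=P_m\,\square\,P_n$ be the grid graph. Then $$\mu(\Gamma_{m,n})=2\cdot\min(m,n).$$
   Context: $P_k$ denotes the path graph with $k$ vertices. The Cartesian product $G_1\,\square\,G_2$ of $G_1=(V_1,E_1)$ and $G_2=(V_2,E_2)$ has vertex set $V_1\times V_2$, with $(u_1,u_2)$ adjacent to $(v_1,v_2)$ iff either $u_1=v_1$ and $u_2v_2\in E_2$, or $u_2=v_2$ and $u_1v_1\in E_1$. For a graph $G=(V,E)$ and $P\subseteq V$, two vertices $u,v\in P$ are mutually visible if there is a shortest $(u,v)$-path in $G$ containing no vertex of $P$ other than $u$ and $v$. $P$ is a mutual-visibility set of $G$ if its vertices are pairwise mutually visible. The mutual-visibility number $\mu(G)$ is the maximum cardinality of a mutual-visibility set of $G$. *)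

theory Defs
  imports "Graph_Theory.Pair_Digraph" "Graph_Theory.Vertex_Walk"
begin

text \<open>
  A finite simple undirected graph is a \<^locale>\<open>pair_graph\<close>: a finite, symmetric, loop-free
  digraph without parallel arcs. Each edge is represented by its two arcs.
\<close>

definition path_graph :: "nat \<Rightarrow> nat pair_pre_digraph" where
  "path_graph k =
     \<lparr> pverts = {..<k},
       parcs = {(i, j). i < k \<and> j < k \<and> (j = Suc i \<or> i = Suc j)} \<rparr>"

definition cartesian_product ::
    "'a pair_pre_digraph \<Rightarrow> 'b pair_pre_digraph \<Rightarrow> ('a \<times> 'b) pair_pre_digraph"
    (infixr \<open>\<box>\<close> 70) where
  "G \<box> H =
     \<lparr> pverts = pverts G \<times> pverts H,
       parcs = {((u1, u2), (v1, v2)).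
         (u1 = v1 \<and> u1 \<in> pverts G \<and> (u2, v2) \<in> parcs H) \<or>
         (u2 = v2 \<and> u2 \<in> pverts H \<and> (u1, v1) \<in> parcs G)} \<rparr>"

definition grid_graph :: "nat \<Rightarrow> nat \<Rightarrow> (nat \<times> nat) pair_pre_digraph" where
  "grid_graph m n = path_graph m \<box> path_graph n"

definition path_between :: "'a pair_pre_digraph \<Rightarrow> 'a \<Rightarrow> 'a vwalk \<Rightarrow> 'a \<Rightarrow> bool" where
  "path_between G u p v \<longleftrightarrow> vpath p (with_proj G) \<and> hd p = u \<and> last p = v"

definition shortest_path :: "'a pair_pre_digraph \<Rightarrow> 'a \<Rightarrow> 'a vwalk \<Rightarrow> 'a \<Rightarrow> bool" where
  "shortest_path G u p v \<longleftrightarrow>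
     path_between G u p v \<and> (\<forall>q. path_between G u q v \<longrightarrow> vwalk_length p \<le> vwalk_length q)"

definition mutually_visible :: "'a pair_pre_digraph \<Rightarrow> 'a set \<Rightarrow> 'a \<Rightarrow> 'a \<Rightarrow> bool" where
  "mutually_visible G P u v \<longleftrightarrow> (\<exists>p. shortest_path G u p v \<and> set p \<inter> P \<subseteq> {u, v})"

text \<open>
  The library predicate \<^const>\<open>pairwise\<close> ranges over distinct elements; a vertex is always
  mutually visible with itself, through the path of length 0.
\<close>

definition mutual_visibility_set :: "'a pair_pre_digraph \<Rightarrow> 'a set \<Rightarrow> bool" where
  "mutual_visibility_set G P \<longleftrightarrow> P \<subseteq> pverts G \<and> pairwise (mutually_visible G P) P"

definition mutual_visibility_number :: "'a pair_pre_digraph \<Rightarrow> nat" where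
  "mutual_visibility_number G = Max {card P | P. mutual_visibility_set G P}"

text \<open>The set under the maximum is finite and nonempty, so the maximum is attained.\<close>

lemma (in pair_graph) mutual_visibility_number_attained:
  "finite {card P | P. mutual_visibility_set G P}"
  "\<exists>P. mutual_visibility_set G P \<and> card P = mutual_visibility_number G"
proof -
  have "{card P | P. mutual_visibility_set G P} \<subseteq> card ` Pow (pverts G)"
    by (auto simp: mutual_visibility_set_def)
  then show fin: "finite {card P | P. mutual_visibility_set G P}"
    by (rule finite_subset) (simp add: pair_finite_verts)
  have "mutual_visibility_set G {}"
    by (simp add: mutual_visibility_set_def)
  then have "{card P | P. mutual_visibility_set G P} \<noteq> {}"
    by blast
  from Max_in[OF fin this]
  show "\<exists>P. mutual_visibility_set G P \<and> card P = mutual_visibility_number G"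
    unfolding mutual_visibility_number_def by auto
qed

lemma pair_graph_path_graph: "pair_graph (path_graph k)"
proof -
  have "finite (parcs (path_graph k))"
    by (rule finite_subset[of _ "{..<k} \<times> {..<k}"]) (auto simp: path_graph_def)
  then show ?thesis
    by unfold_locales (auto simp: path_graph_def symmetric_def intro!: symI)
qed

lemma pair_graph_cartesian_product:
  assumes "pair_graph G" "pair_graph H"
  shows "pair_graph (G \<box> H)"
proof -
  interpret G: pair_graph G by fact
  interpret H: pair_graph H by fact
  have arcs: "parcs (G \<box> H) \<subseteq> pverts (G \<box> H) \<times> pverts (G \<box> H)"
    by (auto simp: cartesian_product_def dest: G.in_arcsD1 G.in_arcsD2 H.in_arcsD1 H.in_arcsD2)
  have fin: "finite (pverts (G \<box> H))"
    by (simp add: cartesian_product_def G.pair_finite_verts H.pair_finite_verts)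
  have "sym (parcs G)" "sym (parcs H)"
    using G.pair_sym_arcs H.pair_sym_arcs by (simp_all add: symmetric_def)
  then have sym: "symmetric (with_proj (G \<box> H))"
    by (auto simp: symmetric_def cartesian_product_def intro!: symI dest: symD)
  show ?thesis
  proof unfold_locales
    fix e assume e: "e \<in> parcs (G \<box> H)"
    show "fst e \<in> pverts (G \<box> H)" "snd e \<in> pverts (G \<box> H)"
      using e arcs by auto
    show "fst e \<noteq> snd e"
      using e G.pair_no_loops H.pair_no_loops by (fastforce simp: cartesian_product_def)
  next
    show "finite (parcs (G \<box> H))"
      using arcs fin by (meson finite_SigmaI finite_subset)
  qed (fact fin sym)+
qed

lemma pair_graph_grid_graph: "pair_graph (grid_graph m n)"
  unfolding grid_graph_def by (intro pair_graph_cartesian_product pair_graph_path_graph)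

end

theory Submission
  imports Defs
begin

text \<open>
  Three collinear vertices are never pairwise visible, because the only geodesic between the outer
  two passes through the middle one; hence every row and every column holds at most two vertices.
  Conversely, with \<open>k = min m n\<close>, the \<open>2k\<close> vertices on the boundary of the region
  \<open>1 \<le> x + y \<le> 2k - 3\<close>, \<open>\<bar>x - y\<bar> \<le> 2\<close> are pairwise visible: from any vertex of the
  region a greedy walk towards a boundary vertex can be kept strictly inside the region until it
  arrives.
\<close>

section \<open>The Manhattan metric, valued in \<open>int\<close> so that no subtraction
  truncates\<close>

definition grid_dist :: "nat \<times> nat \<Rightarrow> nat \<times> nat \<Rightarrow> int" where
  "grid_dist u v = \<bar>int (fst u) - int (fst v)\<bar> + \<bar>int (snd u) - int (snd v)\<bar>"

lemma grid_dist_nonneg: "0 \<le> grid_dist u v"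
  by (simp add: grid_dist_def)

lemma grid_dist_self [simp]: "grid_dist u u = 0"
  by (simp add: grid_dist_def)

lemma grid_dist_eq_0_iff: "grid_dist u v = 0 \<longleftrightarrow> u = v"
  by (cases u; cases v) (auto simp: grid_dist_def)

lemma grid_dist_triangle: "grid_dist u w \<le> grid_dist u v + grid_dist v w"
  by (simp add: grid_dist_def)

lemma grid_dist_step:
  fixes x y x' y' :: nat
  shows "x < x' \<Longrightarrow> grid_dist (x, y) (x + 1, y) = 1 \<and>
      grid_dist (x, y) (x', y') = 1 + grid_dist (x + 1, y) (x', y')"
    and "x' < x \<Longrightarrow> grid_dist (x, y) (x - 1, y) = 1 \<and>
      grid_dist (x, y) (x', y') = 1 + grid_dist (x - 1, y) (x', y')"
    and "y < y' \<Longrightarrow> grid_dist (x, y) (x, y + 1) = 1 \<and>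
      grid_dist (x, y) (x', y') = 1 + grid_dist (x, y + 1) (x', y')"
    and "y' < y \<Longrightarrow> grid_dist (x, y) (x, y - 1) = 1 \<and>
      grid_dist (x, y) (x', y') = 1 + grid_dist (x, y - 1) (x', y')"
  by (simp_all add: grid_dist_def)

lemma pverts_grid_graph: "pverts (grid_graph m n) = {..<m} \<times> {..<n}"
  by (simp add: grid_graph_def cartesian_product_def path_graph_def)

text \<open>Reduces adjacency to the metric, so that walks can be handled by the triangle inequality
  alone.\<close>

lemma parcs_grid_graph:
  "(u, v) \<in> parcs (grid_graph m n) \<longleftrightarrow>
     u \<in> pverts (grid_graph m n) \<and> v \<in> pverts (grid_graph m n) \<and> grid_dist u v = 1"
  by (cases u; cases v)
     (auto simp: grid_graph_def cartesian_product_def path_graph_def grid_dist_def)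

text \<open>Triangle inequality, arc by arc. With \<open>w = hd p\<close> it bounds the length from
  below; on a shortest path it forces every vertex to lie metrically between the ends.\<close>

lemma grid_vwalk_through:
  assumes "vwalk p (with_proj (grid_graph m n))" "w \<in> set p"
  shows "grid_dist (hd p) w + grid_dist w (last p) \<le> int (length p) - 1"
  using assms
proof (induction arbitrary: w)
  case (Base u)
  then show ?case by simp
next
  case (Cons u v es)
  from Cons.hyps have uv: "grid_dist u v = 1"
    by (simp add: parcs_grid_graph)
  have "grid_dist u (last (v # es)) \<le> int (length (v # es))"
    using Cons.IH[of v] uv grid_dist_triangle[of u "last (v # es)" v] by simp
  moreover have "grid_dist u w + grid_dist w (last (v # es)) \<le> int (length (v # es))"
    if "w \<in> set (v # es)"
    using Cons.IH[OF that] uv grid_dist_triangle[of u w v] by simp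
  ultimately show ?case
    using Cons.prems by auto
qed

text \<open>Discrete intermediate values: one arc changes the distance to \<open>c\<close> by at
  most 1, so no radius is skipped.\<close>

lemma grid_vwalk_meets_sphere:
  assumes "vwalk p (with_proj (grid_graph m n))"
    and "grid_dist c (hd p) \<le> r" "r \<le> grid_dist c (last p)"
  shows "\<exists>w\<in>set p. grid_dist c w = r"
  using assms
proof induction
  case (Base u)
  then show ?case by simp
next
  case (Cons u v es)
  from Cons.hyps have uv: "grid_dist u v = 1"
    by (simp add: parcs_grid_graph)
  show ?case
  proof (cases "grid_dist c u = r")
    case False
    then have "grid_dist c v \<le> r"
      using Cons.prems uv grid_dist_triangle[of c v u] by simp
    then show ?thesis
      using Cons.IH Cons.prems by simp
  qed simp
qed

text \<open>A greedy walk inside \<open>A\<close> that loses one unit of distance to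
  \<open>v\<close> per arc reaches \<open>v\<close> after \<open>grid_dist u v\<close> arcs. The
  choice of \<open>A\<close> later controls which vertices the geodesic may use.\<close>

lemma geodesic_by_descent:
  assumes "A \<subseteq> pverts (grid_graph m n)" "u \<in> A" "v \<in> A"
    and step: "\<And>x. x \<in> A \<Longrightarrow> x \<noteq> v \<Longrightarrow>
      \<exists>y\<in>A. grid_dist x y = 1 \<and> grid_dist x v = 1 + grid_dist y v"
  shows "\<exists>p. path_between (grid_graph m n) u p v \<and> int (length p) = grid_dist u v + 1 \<and> set p \<subseteq> A"
proof -
  \<comment> \<open>The extra bound on distances to \<open>v\<close> strengthens the induction: all
    of the tail is strictly closer to \<open>v\<close> than the new head, so the path has no
    repeated vertex.\<close>
  have "\<exists>p. path_between (grid_graph m n) u p v \<and> int (length p) = grid_dist u v + 1 \<and>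
      set p \<subseteq> A \<and> (\<forall>w\<in>set p. grid_dist w v \<le> grid_dist u v)"
    using \<open>u \<in> A\<close>
  proof (induction "nat (grid_dist u v)" arbitrary: u)
    case 0
    then have "u = v"
      using grid_dist_nonneg[of u v] by (simp add: grid_dist_eq_0_iff)
    with 0 assms(1) have "path_between (grid_graph m n) u [v] v"
      by (auto simp: path_between_def vpath_def)
    then show ?case
      using \<open>u = v\<close> 0 by (intro exI[of _ "[v]"]) auto
  next
    case (Suc d)
    then have "u \<noteq> v" by auto
    with step Suc.prems obtain y
      where y: "y \<in> A" "grid_dist u y = 1" "grid_dist u v = 1 + grid_dist y v"
      by blast
    from y(3) Suc.hyps(2) have "d = nat (grid_dist y v)"
      by simp
    from Suc.hyps(1)[OF this y(1)] obtain p where p: "path_between (grid_graph m n) y p v"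
      "int (length p) = grid_dist y v + 1" "set p \<subseteq> A"
      "\<forall>w\<in>set p. grid_dist w v \<le> grid_dist y v"
      by blast
    have ne: "p \<noteq> []"
      using p(1) by (auto simp: path_between_def vpath_def vwalk_def)
    have "u \<notin> set p"
      using p(4) y(3) by auto
    moreover have "vwalk (u # p) (with_proj (grid_graph m n))"
      using p(1) Suc.prems y assms(1)
      by (intro vwalk_consI) (auto simp: path_between_def vpath_def parcs_grid_graph)
    ultimately have "path_between (grid_graph m n) u (u # p) v"
      using p(1) ne by (auto simp: path_between_def vpath_def)
    then show ?case
      using p y Suc.prems by (intro exI[of _ "u # p"]) auto
  qed
  then show ?thesis by blast
qed

lemma grid_geodesic:
  assumes "u \<in> pverts (grid_graph m n)" "v \<in> pverts (grid_graph m n)"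
  shows "\<exists>p. path_between (grid_graph m n) u p v \<and> int (length p) = grid_dist u v + 1"
proof -
  have "\<exists>y\<in>pverts (grid_graph m n). grid_dist x y = 1 \<and> grid_dist x v = 1 + grid_dist y v"
    if x: "x \<in> pverts (grid_graph m n)" "x \<noteq> v" for x
  proof -
    obtain a b c d where xv: "x = (a, b)" "v = (c, d)"
      by fastforce
    \<comment> \<open>Any coordinate that differs from that of \<open>v\<close> can be moved towards
      it without leaving the grid.\<close>
    consider "a < c" | "c < a" | "b < d" | "d < b"
      using x xv by fastforce
    then show ?thesis
    proof cases
      case 1
      then have "(a + 1, b) \<in> pverts (grid_graph m n)"
        using x assms xv by (auto simp: pverts_grid_graph)
      then show ?thesis
        unfolding xv using grid_dist_step(1)[OF 1] by (rule rev_bexI)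
    next
      case 2
      then have "(a - 1, b) \<in> pverts (grid_graph m n)"
        using x assms xv by (auto simp: pverts_grid_graph)
      then show ?thesis
        unfolding xv using grid_dist_step(2)[OF 2] by (rule rev_bexI)
    next
      case 3
      then have "(a, b + 1) \<in> pverts (grid_graph m n)"
        using x assms xv by (auto simp: pverts_grid_graph)
      then show ?thesis
        unfolding xv using grid_dist_step(3)[OF 3] by (rule rev_bexI)
    next
      case 4
      then have "(a, b - 1) \<in> pverts (grid_graph m n)"
        using x assms xv by (auto simp: pverts_grid_graph)
      then show ?thesis
        unfolding xv using grid_dist_step(4)[OF 4] by (rule rev_bexI)
    qed
  qed
  from geodesic_by_descent[OF subset_refl assms this] show ?thesis by blast
qed

lemma shortest_pathI:
  assumes "path_between (grid_graph m n) u p v" "int (length p) = grid_dist u v + 1"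
  shows "shortest_path (grid_graph m n) u p v"
  unfolding shortest_path_def
proof (intro conjI allI impI)
  fix q assume q: "path_between (grid_graph m n) u q v"
  then have "hd q \<in> set q"
    by (auto simp: path_between_def vpath_def vwalk_def)
  with q have "grid_dist u v \<le> int (length q) - 1"
    using grid_vwalk_through[of q m n "hd q"] by (auto simp: path_between_def vpath_def)
  with assms(2) show "vwalk_length p \<le> vwalk_length q"
    by simp
qed fact

lemma shortest_path_length:
  assumes "shortest_path (grid_graph m n) u p v"
  shows "int (length p) \<le> grid_dist u v + 1"
proof -
  have p: "vwalk p (with_proj (grid_graph m n))" "hd p = u" "last p = v"
    using assms by (auto simp: shortest_path_def path_between_def vpath_def)
  then have "p \<noteq> []" "set p \<subseteq> pverts (grid_graph m n)"
    by (auto simp: vwalk_def)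
  with p have "u \<in> pverts (grid_graph m n)" "v \<in> pverts (grid_graph m n)"
    using hd_in_set last_in_set by blast+
  then obtain q where q: "path_between (grid_graph m n) u q v" "int (length q) = grid_dist u v + 1"
    using grid_geodesic by blast
  with assms have "vwalk_length p \<le> vwalk_length q"
    by (auto simp: shortest_path_def)
  with q(2) grid_dist_nonneg[of u v] show ?thesis
    by simp
qed

text \<open>The path meets the sphere around \<open>u\<close> through \<open>w\<close> in some
  \<open>z\<close>. Being on a shortest path, \<open>z\<close> has no slack left to deviate from the
  common line, so it is \<open>w\<close>. The parameter \<open>f\<close> treats rows and columns
  together.\<close>

lemma shortest_path_collinear:
  assumes p: "shortest_path (grid_graph m n) u p v"
    and f: "f = fst \<or> f = snd" "f u = f w" "f w = f v"
    and between: "grid_dist u w + grid_dist w v = grid_dist u v"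
  shows "w \<in> set p"
proof -
  have walk: "vwalk p (with_proj (grid_graph m n))" "hd p = u" "last p = v"
    using p by (auto simp: shortest_path_def path_between_def vpath_def)
  obtain z where z: "z \<in> set p" "grid_dist u z = grid_dist u w"
    using grid_vwalk_meets_sphere[OF walk(1), of u "grid_dist u w"] walk(2,3) between
      grid_dist_nonneg[of u w] grid_dist_nonneg[of w v] by auto
  have "grid_dist u z + grid_dist z v \<le> grid_dist u v"
    using grid_vwalk_through[OF walk(1) z(1)] walk(2,3) shortest_path_length[OF p] by simp
  with z(2) f between have "fst z = fst w \<and> snd z = snd w"
    unfolding grid_dist_def by (elim disjE; hypsubst; smt (verit, best) of_nat_eq_iff)
  then have "z = w"
    by (simp add: prod_eq_iff)
  with z(1) show ?thesis by simp
qed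

section \<open>Upper bound by counting on lines\<close>

lemma mutual_visibility_set_line:
  assumes P: "mutual_visibility_set (grid_graph m n) P"
    and f: "f = fst \<or> f = snd"
  shows "card (P \<inter> f -` {i}) \<le> 2"
proof (rule ccontr)
  assume "\<not> ?thesis"
  then have "3 \<le> card (P \<inter> f -` {i})"
    by simp
  then obtain T where T: "T \<subseteq> P \<inter> f -` {i}" "card T = 3"
    using obtain_subset_with_card_n by metis
  then obtain x y z where xyz: "T = {x, y, z}" "x \<noteq> y" "y \<noteq> z" "x \<noteq> z"
    by (auto simp: card_3_iff)
  have no: False
    if "{u, w, v} \<subseteq> P \<inter> f -` {i}" "w \<noteq> u" "w \<noteq> v" "u \<noteq> v"
      "grid_dist u w + grid_dist w v = grid_dist u v" for u w v
  proof -
    have "mutually_visible (grid_graph m n) P u v"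
      using P that by (auto simp: mutual_visibility_set_def pairwise_def)
    then obtain p where p: "shortest_path (grid_graph m n) u p v" "set p \<inter> P \<subseteq> {u, v}"
      by (auto simp: mutually_visible_def)
    have "w \<in> set p"
      using that f by (intro shortest_path_collinear[OF p(1) f]) auto
    with p(2) that show False by auto
  qed
  have "f x = i" "f y = i" "f z = i"
    using T xyz by auto
  \<comment> \<open>The disjuncts say which vertex is in the middle: \<open>y\<close>,
    \<open>x\<close> or \<open>z\<close>.\<close>
  then have "grid_dist x y + grid_dist y z = grid_dist x z \<or>
      grid_dist y x + grid_dist x z = grid_dist y z \<or>
      grid_dist x z + grid_dist z y = grid_dist x y"
    using f unfolding grid_dist_def by (elim disjE; hypsubst; smt (verit))
  then show False
    using no[of x y z] no[of y x z] no[of x z y] T(1) xyz by auto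
qed

lemma mutual_visibility_set_card_le:
  assumes P: "mutual_visibility_set (grid_graph m n) P"
    and f: "f = fst \<or> f = snd" "f ` P \<subseteq> {..<k}"
  shows "card P \<le> 2 * k"
proof -
  have "P = (\<Union>i<k. P \<inter> f -` {i})"
    using f(2) by auto
  then have "card P \<le> (\<Sum>i<k. card (P \<inter> f -` {i}))"
    by (metis card_UN_le finite_lessThan)
  also have "\<dots> \<le> (\<Sum>i<k. 2)"
    by (intro sum_mono mutual_visibility_set_line[OF P f(1)])
  finally show ?thesis by simp
qed

section \<open>A mutual-visibility set attaining the bound\<close>

text \<open>The interior of the region, where geodesics may run freely; the bounds are written
  additively to avoid truncated subtraction.\<close>

definition inner_band :: "nat \<Rightarrow> (nat \<times> nat) set" where
  "inner_band k = {(x, y). 2 \<le> x + y \<and> x + y + 4 \<le> 2 * k \<and> x \<le> y + 1 \<and> y \<le> x + 1}"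

text \<open>The boundary, listed by sides for counting: two vertices on each of the antidiagonals
  \<open>x + y = 1\<close> and \<open>x + y = 2 * k - 3\<close>, and \<open>k - 2\<close> on each of
  the diagonals \<open>y = x + 2\<close> and \<open>x = y + 2\<close>.\<close>

definition outer_ring :: "nat \<Rightarrow> (nat \<times> nat) set" where
  "outer_ring k = {(0, 1), (1, 0), (k - 1, k - 2), (k - 2, k - 1)} \<union>
     (\<lambda>i. (i, i + 2)) ` {..<k - 2} \<union> (\<lambda>i. (i + 2, i)) ` {..<k - 2}"

lemma outer_ring_bounds:
  assumes "k > 3" "(x, y) \<in> outer_ring k"
  shows "1 \<le> x + y" "x + y + 3 \<le> 2 * k" "x \<le> y + 2" "y \<le> x + 2"
    "x + y = 1 \<or> x + y + 3 = 2 * k \<or> x = y + 2 \<or> y = x + 2"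
  using assms by (auto simp: outer_ring_def)

text \<open>If both coordinates must change in the same direction, moving the one that lags (or
  leads, when decreasing) keeps them within 1 of each other. If they change in opposite directions,
  the difference takes care of itself and only the sum must stay within the band.\<close>

lemma outer_ring_descent:
  assumes "k > 3" "u \<in> outer_ring k \<union> inner_band k" "v \<in> outer_ring k" "u \<noteq> v"
  shows "\<exists>w\<in>insert v (inner_band k). grid_dist u w = 1 \<and> grid_dist u v = 1 + grid_dist w v"
proof -
  obtain x y x' y' where uv: "u = (x, y)" "v = (x', y')"
    by fastforce
  have u: "1 \<le> x + y" "x + y + 3 \<le> 2 * k" "x \<le> y + 2" "y \<le> x + 2"
    using assms(2) outer_ring_bounds[OF assms(1), of x y] uv by (auto simp: inner_band_def)
  have v: "1 \<le> x' + y'" "x' + y' + 3 \<le> 2 * k" "x' \<le> y' + 2" "y' \<le> x' + 2"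
    using assms(3) outer_ring_bounds[OF assms(1), of x' y'] uv by auto
  \<comment> \<open>As \<open>2 * k\<close> is at least 8, no vertex is near both ends: the first
    alternative leaves room to increase the sum, the second to decrease it.\<close>
  have sums: "x + y + 5 \<le> 2 * k \<or> 3 \<le> x + y"
    using assms(1) by linarith
  consider
      (right) "x < x'" "y < y' \<longrightarrow> x \<le> y" "y' < y \<longrightarrow> x + y + 5 \<le> 2 * k"
    | (up) "y < y'" "x < x' \<longrightarrow> y \<le> x" "x' < x \<longrightarrow> x + y + 5 \<le> 2 * k"
    | (left) "x' < x" "y' < y \<longrightarrow> y \<le> x" "y < y' \<longrightarrow> 3 \<le> x + y"
    | (down) "y' < y" "x' < x \<longrightarrow> x \<le> y" "x < x' \<longrightarrow> 3 \<le> x + y"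
    using that assms(1,4) uv linear[of x y] sums
    by (cases x x' rule: linorder_cases; cases y y' rule: linorder_cases) auto
  then show ?thesis
  proof cases
    case right
    \<comment> \<open>When \<open>y = y'\<close>, the new vertex either is \<open>v\<close> or stops
      short of it and hence is interior; otherwise the guards of the case keep it in the
      band.\<close>
    then have "(x + 1, y) \<in> insert (x', y') (inner_band k)"
      using u v uv by (cases y y' rule: linorder_cases) (auto simp: inner_band_def)
    then show ?thesis
      unfolding uv using grid_dist_step(1)[OF right(1)] by (rule rev_bexI)
  next
    case up
    then have "(x, y + 1) \<in> insert (x', y') (inner_band k)"
      using u v uv by (cases x x' rule: linorder_cases) (auto simp: inner_band_def)
    then show ?thesis
      unfolding uv using grid_dist_step(3)[OF up(1)] by (rule rev_bexI)
  next
    case left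
    then have "(x - 1, y) \<in> insert (x', y') (inner_band k)"
      using u v uv by (cases y y' rule: linorder_cases) (auto simp: inner_band_def)
    then show ?thesis
      unfolding uv using grid_dist_step(2)[OF left(1)] by (rule rev_bexI)
  next
    case down
    then have "(x, y - 1) \<in> insert (x', y') (inner_band k)"
      using u v uv by (cases x x' rule: linorder_cases) (auto simp: inner_band_def)
    then show ?thesis
      unfolding uv using grid_dist_step(4)[OF down(1)] by (rule rev_bexI)
  qed
qed

lemma card_outer_ring:
  assumes "k > 3"
  shows "card (outer_ring k) = 2 * k"
proof -
  let ?T = "{(0, 1), (1, 0), (k - 1, k - 2), (k - 2, k - 1)}"
  let ?U = "(\<lambda>i. (i, i + 2)) ` {..<k - 2}" and ?L = "(\<lambda>i. (i + 2, i)) ` {..<k - 2}"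
  have "card ?T = 4" "card ?U = k - 2" "card ?L = k - 2"
    using assms by (auto simp: card_image inj_on_def)
  moreover have "card (?T \<union> ?U) = card ?T + card ?U"
    using assms by (intro card_Un_disjoint) auto
  moreover have "card (?T \<union> ?U \<union> ?L) = card (?T \<union> ?U) + card ?L"
    using assms by (intro card_Un_disjoint) auto
  ultimately have "card (outer_ring k) = 4 + (k - 2) + (k - 2)"
    unfolding outer_ring_def by (simp only:)
  with assms show ?thesis by simp
qed

lemma mutual_visibility_set_outer_ring:
  assumes "k > 3" "k \<le> m" "k \<le> n"
  shows "mutual_visibility_set (grid_graph m n) (outer_ring k)"
proof -
  have ring: "outer_ring k \<subseteq> pverts (grid_graph m n)"
    using assms by (auto simp: outer_ring_def pverts_grid_graph)
  have band: "inner_band k \<subseteq> pverts (grid_graph m n)"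
    using assms by (auto simp: inner_band_def pverts_grid_graph)
  \<comment> \<open>Every ring vertex satisfies one of the boundary equations, which the
    inequalities of the band exclude.\<close>
  have disj: "inner_band k \<inter> outer_ring k = {}"
  proof -
    have False if "(x, y) \<in> inner_band k" "(x, y) \<in> outer_ring k" for x y
      using outer_ring_bounds(5)[OF assms(1) that(2)] that(1) by (auto simp: inner_band_def)
    then show ?thesis by auto
  qed
  have "mutually_visible (grid_graph m n) (outer_ring k) u v"
    if uv: "u \<in> outer_ring k" "v \<in> outer_ring k" for u v
  proof -
    \<comment> \<open>Descent takes place in the band with only \<open>u\<close> and
      \<open>v\<close> added, so the geodesic meets no other ring vertex.\<close>
    have "\<exists>y\<in>{u, v} \<union> inner_band k. grid_dist x y = 1 \<and> grid_dist x v = 1 + grid_dist y v"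
      if "x \<in> {u, v} \<union> inner_band k" "x \<noteq> v" for x
      using outer_ring_descent[OF assms(1), of x v] that uv by blast
    then obtain p where "path_between (grid_graph m n) u p v"
      "int (length p) = grid_dist u v + 1" "set p \<subseteq> {u, v} \<union> inner_band k"
      using geodesic_by_descent[of "{u, v} \<union> inner_band k" m n u v] ring band uv by blast
    then show ?thesis
      using disj unfolding mutually_visible_def by (blast intro: shortest_pathI)
  qed
  with ring show ?thesis
    by (simp add: mutual_visibility_set_def pairwise_def)
qed

theorem theorem4p6:
  fixes m n :: nat
  assumes "m > 3" and "n > 3"
  shows "mutual_visibility_number (grid_graph m n) = 2 * min m n"
  unfolding mutual_visibility_number_def
proof (rule Max_eqI)
  show "finite {card P |P. mutual_visibility_set (grid_graph m n) P}"
    by (rule pair_graph.mutual_visibility_number_attained(1)[OF pair_graph_grid_graph])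
next
  fix c assume "c \<in> {card P |P. mutual_visibility_set (grid_graph m n) P}"
  then obtain P where P: "mutual_visibility_set (grid_graph m n) P" "c = card P"
    by blast
  then have "fst ` P \<subseteq> {..<m}" "snd ` P \<subseteq> {..<n}"
    by (auto simp: mutual_visibility_set_def pverts_grid_graph)
  \<comment> \<open>Counting by first and by second coordinate gives the two bounds whose minimum is
    wanted.\<close>
  then have "card P \<le> 2 * m" "card P \<le> 2 * n"
    using mutual_visibility_set_card_le[OF P(1)] by blast+
  with P(2) show "c \<le> 2 * min m n" by simp
next
  have "mutual_visibility_set (grid_graph m n) (outer_ring (min m n))"
    using assms by (intro mutual_visibility_set_outer_ring) auto
  moreover have "card (outer_ring (min m n)) = 2 * min m n"
    using assms by (intro card_outer_ring) auto
  ultimately show "2 * min m n \<in> {card P |P. mutual_visibility_set (grid_graph m n) P}"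
    by force
qed

end
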